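(* Let $\mathcal{E}$ be convex on $\Delta_{n_{\mathcal{Y}}}$ and let $K\subseteq\mathbb{R}^{n_{\mathcal{Y}}}$ be compact (and non-empty). Then a Stackelberg-Cournot-Nash equilibrium (SCNE) exists.
   Context: $\mathcal{X}=\{x_1,\ldots,x_{n_{\mathcal X}}\}$ (types) and $\mathcal{Y}=\{y_1,\ldots,y_{n_{\mathcal Y}}\}$ (actions) are finite sets. Probability measures on them are identified with vectors in the simplices $\Delta_{n_{\mathcal X}}$, $\Delta_{n_{\mathcal Y}}$, where $\Delta_n=\{\omega\in[0,1]^n:\sum_i\omega_i=1\}$; $\mu\in\Delta_{n_{\mathcal X}}$ is fixed. $\Pi(\mu,\cdot)$ is the set of probability measures $\gamma=(\gamma_{ij})$ on $\mathcal{X}\times\mathcal{Y}$ with first marginal $\mu$ (and arbitrary second marginal); $p_2\#\gamma$ is the second marginal of $\gamma$. The data are: $c\in\mathbb{R}^{n_{\mathcal X}\times n_{\mathcal Y}}$; continuous nondecreasing functions $f_j:[0,1]\to\mathbb{R}$, $j=1,\ldots,n_{\mathcal Y}$; a symmetric matrix $\theta\in\mathbb{R}^{n_{\mathcal Y}\times n_{\mathcal Y}}$; a set $K\subseteq\mathbb{R}^{n_{\mathcal Y}}$; and a continuous function $G:\Delta_{n_{\mathcal Y}}\times K\to\mathbb{R}$, $(\nu,k)\mapsto G(\nu,k)$. For $\nu\in\Delta_{n_{\mathcal Y}}$, $k\in K$, $$C_{ij}[\nu,k]=c_{ij}+k_j+f_j(\nu_j)+\sum_{a=1}^{n_{\mathcal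 Y}}\theta_{aj}\nu_a .$$ The energy is $\mathcal{E}[\nu]=\sum_jF_j(\nu_j)+\tfrac12\sum_{a,j}\theta_{aj}\nu_a\nu_j$ with $F_j(t)=\int_0^tf_j(s)\,ds$. For $k\in K$, $\gamma^k\in\Pi(\mu,\cdot)$ is a Cournot-Nash equilibrium (CNE) w.r.t. $k$ if, with $\nu^k=p_2\#\gamma^k$, $\gamma^k$ minimizes $\gamma\mapsto\sum_{i,j}C_{ij}[\nu^k,k]\gamma_{ij}$ over $\gamma\in\Pi(\mu,\cdot)$. A pair $(\gamma^{k^*},k^* )\in\Pi(\mu,\cdot)\times K$ is a SCNE if (i) $\gamma^{k^*}$ is a CNE w.r.t. $k^*$, and (ii) $G(p_2\#\gamma^{k^*},k^* )\le G(p_2\#\gamma^k,k)$ for all $k\in K$ and all CNE $\gamma^k$ w.r.t. $k$. *)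

theory Defs
  imports "HOL-Analysis.Analysis"
begin

text \<open>
  The type space and the action space are the finite index types \<open>'x\<close> and \<open>'y\<close>.
  Measures on them are weight vectors, and a measure on the product is a matrix \<open>\<gamma>\<close>
  with rows indexed by types, so that \<open>\<gamma> $ i $ j\<close> is the mass at the pair \<open>(i, j)\<close>.
\<close>

definition simplex_weights :: "(real ^ 'n::finite) set" where
  "simplex_weights = {w. (\<forall>i. 0 \<le> w $ i \<and> w $ i \<le> 1) \<and> (\<Sum>i\<in>UNIV. w $ i) = 1}"

definition prob_plans :: "(real ^ 'y::finite ^ 'x::finite) set" where
  "prob_plans =
     {\<gamma>. (\<forall>i j. 0 \<le> \<gamma> $ i $ j \<and> \<gamma> $ i $ j \<le> 1) \<and> (\<Sum>i\<in>UNIV. \<Sum>j\<in>UNIV. \<gamma> $ i $ j) = 1}"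

definition marginal1 :: "real ^ 'y::finite ^ 'x::finite \<Rightarrow> real ^ 'x" where
  "marginal1 \<gamma> = (\<chi> i. \<Sum>j\<in>UNIV. \<gamma> $ i $ j)"

definition marginal2 :: "real ^ 'y::finite ^ 'x::finite \<Rightarrow> real ^ 'y" where
  "marginal2 \<gamma> = (\<chi> j. \<Sum>i\<in>UNIV. \<gamma> $ i $ j)"

definition plans_from :: "real ^ 'x::finite \<Rightarrow> (real ^ 'y::finite ^ 'x) set" where
  "plans_from \<mu> = {\<gamma> \<in> prob_plans. marginal1 \<gamma> = \<mu>}"

definition cost ::
    "real ^ 'y ^ 'x \<Rightarrow> ('y \<Rightarrow> real \<Rightarrow> real) \<Rightarrow> real ^ 'y ^ 'y \<Rightarrow>
     real ^ 'y \<Rightarrow> real ^ 'y \<Rightarrow> real ^ 'y::finite ^ 'x::finite" where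
  "cost c f \<theta> \<nu> k =
     (\<chi> i j. c $ i $ j + k $ j + f j (\<nu> $ j) + (\<Sum>a\<in>UNIV. \<theta> $ a $ j * \<nu> $ a))"

definition total_cost :: "real ^ 'y::finite ^ 'x::finite \<Rightarrow> real ^ 'y ^ 'x \<Rightarrow> real" where
  "total_cost C \<gamma> = (\<Sum>i\<in>UNIV. \<Sum>j\<in>UNIV. C $ i $ j * \<gamma> $ i $ j)"

definition energy ::
    "('y \<Rightarrow> real \<Rightarrow> real) \<Rightarrow> real ^ 'y ^ 'y \<Rightarrow> real ^ 'y::finite \<Rightarrow> real" where
  "energy f \<theta> \<nu> =
     (\<Sum>j\<in>UNIV. integral {0..\<nu> $ j} (f j))
     + 1 / 2 * (\<Sum>a\<in>UNIV. \<Sum>j\<in>UNIV. \<theta> $ a $ j * \<nu> $ a * \<nu> $ j)"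

text \<open>
  Being a Cournot-Nash equilibrium is a fixed-point condition: the cost that \<open>\<gamma>\<close>
  minimizes is the one induced by its own second marginal.
\<close>

definition CNE ::
    "real ^ 'x \<Rightarrow> real ^ 'y ^ 'x \<Rightarrow> ('y \<Rightarrow> real \<Rightarrow> real) \<Rightarrow> real ^ 'y ^ 'y \<Rightarrow>
     real ^ 'y \<Rightarrow> real ^ 'y::finite ^ 'x::finite \<Rightarrow> bool" where
  "CNE \<mu> c f \<theta> k \<gamma> \<longleftrightarrow>
     \<gamma> \<in> plans_from \<mu> \<and>
     (\<forall>\<gamma>' \<in> plans_from \<mu>.
        total_cost (cost c f \<theta> (marginal2 \<gamma>) k) \<gamma> \<le> total_cost (cost c f \<theta> (marginal2 \<gamma>) k) \<gamma>')"

definition SCNE ::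
    "real ^ 'x \<Rightarrow> real ^ 'y ^ 'x \<Rightarrow> ('y \<Rightarrow> real \<Rightarrow> real) \<Rightarrow> real ^ 'y ^ 'y \<Rightarrow>
     (real ^ 'y) set \<Rightarrow> (real ^ 'y \<Rightarrow> real ^ 'y \<Rightarrow> real) \<Rightarrow>
     real ^ 'y::finite ^ 'x::finite \<Rightarrow> real ^ 'y \<Rightarrow> bool" where
  "SCNE \<mu> c f \<theta> K G \<gamma> k \<longleftrightarrow>
     k \<in> K \<and> CNE \<mu> c f \<theta> k \<gamma> \<and>
     (\<forall>k'\<in>K. \<forall>\<gamma>'. CNE \<mu> c f \<theta> k' \<gamma>' \<longrightarrow> G (marginal2 \<gamma>) k \<le> G (marginal2 \<gamma>') k')"

end

theory Submission
  imports Defs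
begin

text \<open>
  For each \<open>k\<close>, a minimizer over \<open>\<Pi>(\<mu>,\<cdot>)\<close> of the potential
  \<open>\<Sum>ij (c_ij + k_j) \<gamma>_ij + E[p2#\<gamma>]\<close> is an equilibrium: symmetry of \<open>\<theta>\<close> makes the equilibrium
  condition the first-order condition of this problem.  The equilibrium condition is a family of
  weak inequalities between continuous functions of \<open>(k, \<gamma>)\<close>, so the equilibrium pairs form a
  nonempty compact set, on which the continuous leader objective attains its minimum.
\<close>

text \<open>The bounds by 1 and the total mass follow from nonnegativity and the row sums, because
  each \<open>\<mu> $ i\<close> is at most 1 and the weights of \<open>\<mu>\<close> sum to 1. What
  remains is a system of linear constraints, from which closedness and convexity are read
  off.\<close>

lemma plans_from_iff:
  assumes "\<mu> \<in> simplex_weights"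
  shows "\<gamma> \<in> plans_from \<mu> \<longleftrightarrow> (\<forall>i j. 0 \<le> \<gamma> $ i $ j) \<and> (\<forall>i. (\<Sum>j\<in>UNIV. \<gamma> $ i $ j) = \<mu> $ i)"
proof
  assume "\<gamma> \<in> plans_from \<mu>"
  then show "(\<forall>i j. 0 \<le> \<gamma> $ i $ j) \<and> (\<forall>i. (\<Sum>j\<in>UNIV. \<gamma> $ i $ j) = \<mu> $ i)"
    by (auto simp: plans_from_def prob_plans_def marginal1_def)
next
  assume *: "(\<forall>i j. 0 \<le> \<gamma> $ i $ j) \<and> (\<forall>i. (\<Sum>j\<in>UNIV. \<gamma> $ i $ j) = \<mu> $ i)"
  have "\<gamma> $ i $ j \<le> 1" for i j
  proof -
    have "\<gamma> $ i $ j \<le> (\<Sum>j\<in>UNIV. \<gamma> $ i $ j)"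
      using * by (intro member_le_sum) auto
    also have "\<dots> \<le> 1"
      using * assms by (auto simp: simplex_weights_def)
    finally show ?thesis .
  qed
  with * assms show "\<gamma> \<in> plans_from \<mu>"
    by (auto simp: plans_from_def prob_plans_def marginal1_def simplex_weights_def)
qed

lemma plans_from_nonempty:
  assumes "\<mu> \<in> simplex_weights"
  shows "plans_from \<mu> \<noteq> {}"
proof -
  \<comment> \<open>All types play one and the same action; \<open>undefined\<close> is merely some
    fixed element of \<open>'y\<close>.\<close>
  have "(\<chi> i j. if j = undefined then \<mu> $ i else 0) \<in> plans_from \<mu>"
    using assms unfolding plans_from_iff[OF assms] by (auto simp: simplex_weights_def)
  then show ?thesis by blast
qed

lemma compact_plans_from:
  assumes "\<mu> \<in> simplex_weights"
  shows "compact (plans_from \<mu> :: (real ^ 'y::finite ^ 'x::finite) set)"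
proof -
  let ?P = "plans_from \<mu> :: (real ^ 'y ^ 'x) set"
  have "closed ?P"
  proof -
    have "?P = (\<Inter>i j. {\<gamma>. 0 \<le> \<gamma> $ i $ j}) \<inter> (\<Inter>i. {\<gamma>. (\<Sum>j\<in>UNIV. \<gamma> $ i $ j) = \<mu> $ i})"
      by (auto simp: plans_from_iff[OF assms])
    then show ?thesis
      by (auto intro!: closed_Int closed_INT closed_Collect_le closed_Collect_eq continuous_intros)
  qed
  moreover have "bounded ?P"
  proof -
    have "?P \<subseteq> cbox 0 (\<chi> i j. 1)"
    proof
      fix \<gamma> :: "real ^ 'y ^ 'x" assume "\<gamma> \<in> ?P"
      then show "\<gamma> \<in> cbox 0 (\<chi> i j. 1)"
        by (auto simp: plans_from_def prob_plans_def mem_box Basis_vec_def inner_axis)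
    qed
    then show ?thesis
      using bounded_cbox bounded_subset by blast
  qed
  ultimately show ?thesis
    by (simp add: compact_eq_bounded_closed)
qed

lemma convex_plans_from:
  assumes "\<mu> \<in> simplex_weights"
  shows "convex (plans_from \<mu>)"
  by (rule convexI)
    (auto simp: plans_from_iff[OF assms] sum.distrib simp flip: sum_distrib_left distrib_right)

lemma marginal2_in_simplex_weights:
  assumes "\<gamma> \<in> plans_from \<mu>"
  shows "marginal2 \<gamma> \<in> simplex_weights"
proof -
  have nn: "0 \<le> marginal2 \<gamma> $ j" for j
    using assms by (auto simp: marginal2_def plans_from_def prob_plans_def intro: sum_nonneg)
  have s: "(\<Sum>j\<in>UNIV. marginal2 \<gamma> $ j) = 1"
    using assms sum.swap[of "\<lambda>i j. \<gamma> $ i $ j" UNIV UNIV]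
    by (simp add: marginal2_def plans_from_def prob_plans_def)
  have "marginal2 \<gamma> $ j \<le> 1" for j
    unfolding s[symmetric] using nn by (intro member_le_sum) auto
  with nn s show ?thesis by (simp add: simplex_weights_def)
qed

lemma marginal2_mem_Icc:
  assumes "\<gamma> \<in> plans_from \<mu>"
  shows "marginal2 \<gamma> $ j \<in> {0..1}"
  using marginal2_in_simplex_weights[OF assms] by (simp add: simplex_weights_def)

lemma marginal2_add: "marginal2 (\<gamma> + \<gamma>') = marginal2 \<gamma> + marginal2 \<gamma>'"
  by (simp add: marginal2_def vec_eq_iff sum.distrib)

lemma marginal2_scaleR: "marginal2 (t *\<^sub>R \<gamma>) = t *\<^sub>R marginal2 \<gamma>"
  by (simp add: marginal2_def vec_eq_iff sum_distrib_left)

lemma total_cost_add: "total_cost C (\<gamma> + \<gamma>') = total_cost C \<gamma> + total_cost C \<gamma>'"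
  by (simp add: total_cost_def sum.distrib distrib_left)

lemma total_cost_diff: "total_cost C (\<gamma> - \<gamma>') = total_cost C \<gamma> - total_cost C \<gamma>'"
  by (simp add: total_cost_def sum_subtractf right_diff_distrib)

lemma total_cost_scaleR: "total_cost C (t *\<^sub>R \<gamma>) = t * total_cost C \<gamma>"
  by (simp add: total_cost_def sum_distrib_left mult_ac)

lemma continuous_on_marginal2 [continuous_intros]:
  "continuous_on S g \<Longrightarrow> continuous_on S (\<lambda>x. marginal2 (g x))"
  unfolding marginal2_def by (intro continuous_intros)

lemma continuous_on_total_cost [continuous_intros]:
  "continuous_on S C \<Longrightarrow> continuous_on S g \<Longrightarrow> continuous_on S (\<lambda>x. total_cost (C x) (g x))"
  unfolding total_cost_def by (intro continuous_intros)

text \<open>Continuity of \<open>f j\<close> is available on \<open>{0..1}\<close> alone, so the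
  coordinates of \<open>\<nu>\<close> must stay in that interval for the composition to be
  continuous.\<close>

lemma continuous_on_cost:
  assumes "\<And>j. continuous_on {0..1} (f j)"
    and "continuous_on S \<nu>" "continuous_on S k"
    and "\<And>x j. x \<in> S \<Longrightarrow> \<nu> x $ j \<in> {0..1}"
  shows "continuous_on S (\<lambda>x. cost c f \<theta> (\<nu> x) (k x))"
proof -
  have "continuous_on S (\<lambda>x. f j (\<nu> x $ j))" for j
    using assms(4) by (intro continuous_on_compose2[OF assms(1)] continuous_intros assms(2)) auto
  then show ?thesis
    unfolding cost_def by (intro continuous_intros assms)
qed

lemma continuous_on_energy:
  assumes "\<And>j. continuous_on {0..1} (f j)"
    and "continuous_on S \<nu>"
    and "\<And>x j. x \<in> S \<Longrightarrow> \<nu> x $ j \<in> {0..1}"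
  shows "continuous_on S (\<lambda>x. energy f \<theta> (\<nu> x))"
proof -
  \<comment> \<open>The primitive of a continuous function is continuous in its upper limit.\<close>
  have "continuous_on {0..1} (\<lambda>t. integral {0..t} (f j))" for j
    by (intro indefinite_integral_continuous_1 integrable_continuous_real assms)
  then have "continuous_on S (\<lambda>x. integral {0..\<nu> x $ j} (f j))" for j
    by (rule continuous_on_compose2) (use assms(2,3) in \<open>auto intro!: continuous_intros\<close>)
  then show ?thesis
    unfolding energy_def by (intro continuous_intros assms)
qed

text \<open>The primitives are differentiated by the fundamental theorem of calculus and the chain
  rule. The quadratic term yields two bilinear sums, equal by symmetry of \<open>\<theta>\<close>,
  and their sum cancels the factor 1/2. The derivative is one-sided since the segment is known to
  stay in the unit cube only for \<open>t\<close> in \<open>{0..1}\<close>.\<close>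

lemma energy_has_derivative_along_segment:
  assumes cont: "\<And>j. continuous_on {0..1} (f j)"
    and sym: "transpose \<theta> = \<theta>"
    and seg: "\<And>t j. t \<in> {0..1} \<Longrightarrow> (\<nu> + t *\<^sub>R \<delta>) $ j \<in> {0..1}"
  shows "((\<lambda>t. energy f \<theta> (\<nu> + t *\<^sub>R \<delta>)) has_real_derivative
           (\<Sum>j\<in>UNIV. (f j (\<nu> $ j) + (\<Sum>a\<in>UNIV. \<theta> $ a $ j * \<nu> $ a)) * \<delta> $ j)) (at 0 within {0..1})"
proof -
  have lin: "((\<lambda>t. integral {0..\<nu> $ j + t * \<delta> $ j} (f j)) has_real_derivative f j (\<nu> $ j) * \<delta> $ j)
      (at 0 within {0..1})" for j
  proof -
    let ?l = "\<lambda>t. \<nu> $ j + t * \<delta> $ j"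
    have "\<nu> $ j \<in> {0..1}" using seg[of 0] by simp
    then have "((\<lambda>x. integral {0..x} (f j)) has_real_derivative f j (\<nu> $ j))
        (at (\<nu> $ j) within {0..1})"
      by (intro integral_has_real_derivative cont)
    moreover have "?l ` {0..1} \<subseteq> {0..1}"
      using seg by auto
    \<comment> \<open>The chain rule within a set needs the outer derivative within the image of
      \<open>{0..1}\<close> under \<open>?l\<close>; it is restricted from the larger set
      \<open>{0..1}\<close>.\<close>
    ultimately have "((\<lambda>x. integral {0..x} (f j)) has_real_derivative f j (\<nu> $ j))
        (at (?l 0) within ?l ` {0..1})"
      using DERIV_subset by fastforce
    moreover have "(?l has_real_derivative \<delta> $ j) (at 0 within {0..1})"
      by (auto intro!: derivative_eq_intros)
    ultimately show ?thesis
      using DERIV_image_chain[of "\<lambda>x. integral {0..x} (f j)" _ ?l 0 "{0..1}"]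
      by (simp add: o_def)
  qed
  have \<theta>_sym: "\<theta> $ a $ j = \<theta> $ j $ a" for a j
    using sym by (metis transpose_def vec_lambda_beta)
  \<comment> \<open>Exchanging the roles of \<open>a\<close> and \<open>j\<close> turns one bilinear
    sum into the other; this is where symmetry enters.\<close>
  have "(\<Sum>a\<in>UNIV. \<Sum>j\<in>UNIV. \<theta> $ a $ j * \<delta> $ a * \<nu> $ j) =
      (\<Sum>a\<in>UNIV. \<Sum>j\<in>UNIV. \<theta> $ a $ j * \<nu> $ a * \<delta> $ j)"
    by (subst sum.swap) (simp add: \<theta>_sym mult_ac)
  moreover have "(\<Sum>j\<in>UNIV. (\<Sum>a\<in>UNIV. \<theta> $ a $ j * \<nu> $ a) * \<delta> $ j) =
      (\<Sum>a\<in>UNIV. \<Sum>j\<in>UNIV. \<theta> $ a $ j * \<nu> $ a * \<delta> $ j)"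
    unfolding sum_distrib_right by (rule sum.swap)
  ultimately have quad: "1 / 2 * (\<Sum>a\<in>UNIV. \<Sum>j\<in>UNIV. \<theta> $ a $ j * \<delta> $ a * \<nu> $ j + \<theta> $ a $ j * \<nu> $ a * \<delta> $ j) =
      (\<Sum>j\<in>UNIV. (\<Sum>a\<in>UNIV. \<theta> $ a $ j * \<nu> $ a) * \<delta> $ j)"
    by (simp add: sum.distrib)
  have "((\<lambda>t. energy f \<theta> (\<nu> + t *\<^sub>R \<delta>)) has_real_derivative
      (\<Sum>j\<in>UNIV. f j (\<nu> $ j) * \<delta> $ j) +
      1 / 2 * (\<Sum>a\<in>UNIV. \<Sum>j\<in>UNIV. \<theta> $ a $ j * \<delta> $ a * \<nu> $ j + \<theta> $ a $ j * \<nu> $ a * \<delta> $ j))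
      (at 0 within {0..1})"
    unfolding energy_def
    by (auto intro!: DERIV_add DERIV_sum DERIV_cmult lin)
      (auto intro!: derivative_eq_intros sum.cong simp: algebra_simps)
  then show ?thesis
    unfolding quad by (simp add: distrib_right sum.distrib)
qed

text \<open>Isolates the part of the cost that sees the plan only through its second marginal. Its
  coefficients are those in the directional derivative of \<open>energy\<close> at
  \<open>\<nu>\<close>, which links the equilibrium cost to the potential.\<close>

lemma total_cost_cost:
  "total_cost (cost c f \<theta> \<nu> k) \<gamma> = total_cost (\<chi> i j. c $ i $ j + k $ j) \<gamma> +
     (\<Sum>j\<in>UNIV. (f j (\<nu> $ j) + (\<Sum>a\<in>UNIV. \<theta> $ a $ j * \<nu> $ a)) * marginal2 \<gamma> $ j)"
proof -
  have "(\<Sum>j\<in>UNIV. (f j (\<nu> $ j) + (\<Sum>a\<in>UNIV. \<theta> $ a $ j * \<nu> $ a)) * marginal2 \<gamma> $ j) =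
      (\<Sum>i\<in>UNIV. \<Sum>j\<in>UNIV. (f j (\<nu> $ j) + (\<Sum>a\<in>UNIV. \<theta> $ a $ j * \<nu> $ a)) * \<gamma> $ i $ j)"
    by (subst sum.swap) (simp add: marginal2_def sum_distrib_left)
  then show ?thesis
    by (simp add: total_cost_def cost_def algebra_simps flip: sum.distrib)
qed

text \<open>The one-sided derivative of the potential at \<open>\<gamma>\<close> towards a
  competitor \<open>\<gamma>'\<close> is \<open>total_cost ?C (\<gamma>' - \<gamma>)\<close>, with
  the cost frozen at the marginal of \<open>\<gamma>\<close>. Minimality makes it nonnegative, and
  linearity of \<open>total_cost\<close> in the plan turns this into the equilibrium
  inequality.\<close>

lemma potential_minimizer_is_CNE:
  fixes \<gamma> :: "real ^ 'y::finite ^ 'x::finite"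
  assumes \<mu>: "\<mu> \<in> simplex_weights"
    and cont: "\<And>j. continuous_on {0..1} (f j)"
    and sym: "transpose \<theta> = \<theta>"
    and \<gamma>: "\<gamma> \<in> plans_from \<mu>"
    and min: "\<And>\<gamma>'. \<gamma>' \<in> plans_from \<mu> \<Longrightarrow>
      total_cost (\<chi> i j. c $ i $ j + k $ j) \<gamma> + energy f \<theta> (marginal2 \<gamma>) \<le>
      total_cost (\<chi> i j. c $ i $ j + k $ j) \<gamma>' + energy f \<theta> (marginal2 \<gamma>')"
  shows "CNE \<mu> c f \<theta> k \<gamma>"
  unfolding CNE_def
proof (intro conjI ballI \<gamma>)
  fix \<gamma>' :: "real ^ 'y ^ 'x" assume \<gamma>': "\<gamma>' \<in> plans_from \<mu>"
  let ?b = "\<chi> i j. c $ i $ j + k $ j" and ?d = "\<gamma>' - \<gamma>" and ?\<nu> = "marginal2 \<gamma>"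
  let ?C = "cost c f \<theta> ?\<nu> k"
  let ?J = "\<lambda>\<gamma>. total_cost ?b \<gamma> + energy f \<theta> (marginal2 \<gamma>)"
  have seg: "\<gamma> + t *\<^sub>R ?d \<in> plans_from \<mu>" if "t \<in> {0..1}" for t
  proof -
    have "(1 - t) *\<^sub>R \<gamma> + t *\<^sub>R \<gamma>' \<in> plans_from \<mu>"
      using that convexD[OF convex_plans_from[OF \<mu>] \<gamma> \<gamma>', of "1 - t" t] by simp
    then show ?thesis by (simp add: algebra_simps)
  qed
  have "((\<lambda>t. energy f \<theta> (?\<nu> + t *\<^sub>R marginal2 ?d)) has_real_derivative
      (\<Sum>j\<in>UNIV. (f j (?\<nu> $ j) + (\<Sum>a\<in>UNIV. \<theta> $ a $ j * ?\<nu> $ a)) * marginal2 ?d $ j))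
      (at 0 within {0..1})"
    using marginal2_mem_Icc[OF seg]
    by (intro energy_has_derivative_along_segment cont sym)
      (simp add: marginal2_add marginal2_scaleR)
  \<comment> \<open>The linear part contributes the slope \<open>total_cost ?b ?d\<close>; together
    with the slope of the energy it is \<open>total_cost ?C ?d\<close> by
    \<open>total_cost_cost\<close>.\<close>
  then have "((\<lambda>t. total_cost ?b \<gamma> + t * total_cost ?b ?d + energy f \<theta> (?\<nu> + t *\<^sub>R marginal2 ?d))
      has_real_derivative total_cost ?C ?d) (at 0 within {0..1})"
    unfolding total_cost_cost by (auto intro!: derivative_eq_intros)
  then have deriv: "((\<lambda>t. ?J (\<gamma> + t *\<^sub>R ?d)) has_real_derivative total_cost ?C ?d) (at 0 within {0..1})"
    by (simp add: marginal2_add marginal2_scaleR total_cost_add total_cost_scaleR)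
  have "0 \<le> total_cost ?C ?d"
  proof (rule ccontr)
    assume "\<not> 0 \<le> total_cost ?C ?d"
    then obtain e where "e > 0"
      and e: "\<And>h. \<lbrakk>h > 0; h \<in> {0..1}; h < e\<rbrakk> \<Longrightarrow> ?J (\<gamma> + h *\<^sub>R ?d) < ?J \<gamma>"
      using has_real_derivative_neg_dec_right[OF deriv] by force
    \<comment> \<open>The bound 1 keeps the point on the segment between the two plans, and
      \<open>e / 2\<close> puts it strictly inside the range of descent.\<close>
    define h where "h = min 1 (e / 2)"
    have "h > 0" "h \<in> {0..1}" "h < e"
      using \<open>e > 0\<close> by (auto simp: h_def)
    then show False
      using e min[OF seg] by fastforce
  qed
  then show "total_cost ?C \<gamma> \<le> total_cost ?C \<gamma>'"
    by (simp add: total_cost_diff)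
qed

lemma CNE_exists:
  fixes c :: "real ^ 'y::finite ^ 'x::finite"
  assumes \<mu>: "\<mu> \<in> simplex_weights"
    and cont: "\<And>j. continuous_on {0..1} (f j)"
    and sym: "transpose \<theta> = \<theta>"
  shows "\<exists>\<gamma>. CNE \<mu> c f \<theta> k \<gamma>"
proof -
  let ?J = "\<lambda>\<gamma>. total_cost (\<chi> i j. c $ i $ j + k $ j) \<gamma> + energy f \<theta> (marginal2 \<gamma>)"
  have "continuous_on (plans_from \<mu>) ?J"
    by (intro continuous_intros continuous_on_energy cont marginal2_mem_Icc)
  from continuous_attains_inf[OF compact_plans_from[OF \<mu>] plans_from_nonempty[OF \<mu>] this]
  show ?thesis
    using potential_minimizer_is_CNE[where f = f, OF \<mu> cont sym] by blast
qed

text \<open>The set of competitors \<open>\<gamma>'\<close> is the same for every \<open>k\<close>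
  and every \<open>\<gamma>\<close>. For a fixed competitor both sides of the inequality are
  continuous in the pair, so the equilibrium pairs are an intersection of closed subsets of the
  compact set \<open>?P \<times> K\<close>.\<close>

lemma compact_CNE_pairs:
  fixes c :: "real ^ 'y::finite ^ 'x::finite"
  assumes \<mu>: "\<mu> \<in> simplex_weights"
    and cont: "\<And>j. continuous_on {0..1} (f j)"
    and K: "compact K"
  shows "compact {(\<gamma>, k). k \<in> K \<and> CNE \<mu> c f \<theta> k \<gamma>}"
proof -
  let ?P = "plans_from \<mu> :: (real ^ 'y ^ 'x) set"
  let ?C = "\<lambda>p. cost c f \<theta> (marginal2 (fst p)) (snd p)"
  let ?S = "\<lambda>\<gamma>'. {p \<in> ?P \<times> K. total_cost (?C p) (fst p) \<le> total_cost (?C p) \<gamma>'}"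
  have PK: "compact (?P \<times> K)"
    by (intro compact_Times compact_plans_from \<mu> K)
  have C: "continuous_on (?P \<times> K) ?C"
    by (intro continuous_on_cost cont continuous_intros marginal2_mem_Icc) auto
  have "closed (?S \<gamma>')" for \<gamma>'
    by (intro continuous_on_closed_Collect_le continuous_intros C compact_imp_closed PK)
  then have "compact ((?P \<times> K) \<inter> (\<Inter>\<gamma>'\<in>?P. ?S \<gamma>'))"
    by (intro compact_Int_closed PK closed_INT ballI)
  also have "(?P \<times> K) \<inter> (\<Inter>\<gamma>'\<in>?P. ?S \<gamma>') = {(\<gamma>, k). k \<in> K \<and> CNE \<mu> c f \<theta> k \<gamma>}"
    by (auto simp: CNE_def)
  finally show ?thesis .
qed

theorem proposition5p5:
  fixes \<mu> :: "real ^ 'x::finite"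
    and c :: "real ^ 'y::finite ^ 'x"
    and f :: "'y \<Rightarrow> real \<Rightarrow> real"
    and \<theta> :: "real ^ 'y ^ 'y"
    and K :: "(real ^ 'y) set"
    and G :: "real ^ 'y \<Rightarrow> real ^ 'y \<Rightarrow> real"
  assumes "\<mu> \<in> simplex_weights"
    and "\<And>j. continuous_on {0..1} (f j)"
    and "\<And>j. mono_on {0..1} (f j)"
    and "transpose \<theta> = \<theta>"
    and "continuous_on (simplex_weights \<times> K) (\<lambda>(\<nu>, k). G \<nu> k)"
    and "convex_on simplex_weights (energy f \<theta>)"
    and "compact K"
    and "K \<noteq> {}"
  shows "\<exists>\<gamma> k. SCNE \<mu> c f \<theta> K G \<gamma> k"
proof -
  let ?S = "{(\<gamma>, k). k \<in> K \<and> CNE \<mu> c f \<theta> k \<gamma>}"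
  from \<open>K \<noteq> {}\<close> obtain k where "k \<in> K" by blast
  moreover obtain \<gamma> where "CNE \<mu> c f \<theta> k \<gamma>"
    using CNE_exists[where f = f, OF assms(1,2,4)] by blast
  ultimately have "?S \<noteq> {}" by blast
  moreover have "continuous_on ?S (\<lambda>p. G (marginal2 (fst p)) (snd p))"
  proof -
    \<comment> \<open>\<open>G\<close> is continuous on \<open>simplex_weights \<times> K\<close>,
      so the objective is factored through the map from equilibrium pairs into that product.\<close>
    have 1: "continuous_on ?S (\<lambda>p. (marginal2 (fst p), snd p))"
      by (intro continuous_intros)
    have 2: "(\<lambda>p. (marginal2 (fst p), snd p)) ` ?S \<subseteq> simplex_weights \<times> K"
      by (auto simp: CNE_def intro: marginal2_in_simplex_weights)
    show ?thesis
      using continuous_on_compose2[OF assms(5) 1 2] by simp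
  qed
  \<comment> \<open>Minimizing over plan and parameter jointly compares against every equilibrium of
    every \<open>k'\<close>, as \<open>SCNE\<close> demands.\<close>
  ultimately obtain p where "p \<in> ?S"
    and "\<And>q. q \<in> ?S \<Longrightarrow> G (marginal2 (fst p)) (snd p) \<le> G (marginal2 (fst q)) (snd q)"
    using continuous_attains_inf[OF compact_CNE_pairs[where f = f, OF assms(1,2,7)]] by blast
  then have "SCNE \<mu> c f \<theta> K G (fst p) (snd p)"
    by (force simp: SCNE_def)
  then show ?thesis by blast
qed

end
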